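(* Let $R$ be a commutative ring with identity, let $L$ be a finite meet semilattice with Möbius function $\mu$, and let $f\in I(L,R)$. Suppose $S\subseteq L$ is meet closed, and fix a linear extension $a_1,a_2,\ldots,a_n$ of the partial order on $S$ (so that $a_i<a_j$ implies $i<j$). Let $(S)_f$ be the $n\times n$ matrix whose $(i,j)$ entry is $f(a_i\wedge a_j,\,a_i)$. Then $$\det(S)_f=\prod_{i=1}^n\left(\sum_{d\unlhd a_i}\ \sum_{c\in L}\mu(c,d)\,f(c,a_i)\right),$$ where the inner sum over $d$ ranges over all $d\in L$ with $d\unlhd a_i$.
   Context: For a finite poset $L$ and a commutative ring $R$ with identity, the incidence algebra $I(L,R)$ consists of all functions $F:L\times L\to R$ with $F(a,b)=0$ unless $a\le b$. The Möbius function $\mu\in I(L,R)$ is the inverse of the zeta function $\zeta$ ($\zeta(a,b)=1$ if $a\le b$, $0$ otherwise), i.e. the unique element with $\sum_{a\le c\le b}\mu(a,c)=\delta(a,b)$ for all $a\le b$ (and $\mu(a,b)=0$ unless $a\le b$). A meet semilattice is a poset in which every two elements $a,b$ have a greatest lower bound $a\wedge b$. A subset $S\subseteq L$ is meet closed if $a,b\in S$ implies $a\wedge b\in S$ (meet taken in $L$). For $d\in L$ and the fixed linear extension $a_1,\ldots,a_n$ of $S$, write $d\unlhd a_i$ if $d\le a_i$ and $d\not\le a_j$ for every $j<i$. *)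

theory Defs
  imports "Jordan_Normal_Form.Determinant"
begin

text \<open>The finite poset \<open>L\<close> is the whole type \<open>'a\<close> (of class \<open>finite\<close> and \<open>order\<close>); functions on
  \<open>L \<times> L\<close> are curried.\<close>

definition incidence_algebra :: "('a::order \<Rightarrow> 'a \<Rightarrow> 'r::comm_ring_1) set" where
  "incidence_algebra = {F. \<forall>a b. \<not> a \<le> b \<longrightarrow> F a b = 0}"

text \<open>The condition on the sums says that \<open>m\<close>, multiplied with the zeta function in the incidence
  algebra, gives the identity; \<open>moebius_ex1\<close> shows that the description is proper.\<close>

definition moebius :: "'a::{finite,order} \<Rightarrow> 'a \<Rightarrow> 'r::comm_ring_1" where
  "moebius = (THE m. m \<in> incidence_algebra \<and>
     (\<forall>a b. a \<le> b \<longrightarrow> (\<Sum>c\<in>{a..b}. m a c) = (if a = b then 1 else 0)))"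

context
  notes sum.cong [fundef_cong]
begin

function moebius_rec :: "'a::{finite,order} \<Rightarrow> 'a \<Rightarrow> 'r::comm_ring_1" where
  "moebius_rec a b =
     (if a = b then 1 else if a \<le> b then - (\<Sum>c\<in>{a..<b}. moebius_rec a c) else 0)"
  by pat_completeness auto

termination
proof (relation "measure (\<lambda>(a, b). card {..b})")
  fix a b c :: 'a
  assume "c \<in> {a..<b}"
  then have "{..c} \<subset> {..b}" by auto
  then show "((a, c), (a, b)) \<in> measure (\<lambda>(a, b). card {..b})"
    by (simp add: psubset_card_mono)
qed simp

end

declare moebius_rec.simps [simp del]

lemma sum_atLeastAtMost_last:
  fixes a b :: "'a::{finite,order}" and g :: "'a \<Rightarrow> 'r::comm_ring_1"
  assumes "a \<le> b"
  shows "(\<Sum>c\<in>{a..b}. g c) = g b + (\<Sum>c\<in>{a..<b}. g c)"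
proof -
  have "{a..b} = insert b {a..<b}" using assms by auto
  then show ?thesis by simp
qed

lemma moebius_ex1:
  "\<exists>!m :: 'a::{finite,order} \<Rightarrow> 'a \<Rightarrow> 'r::comm_ring_1. m \<in> incidence_algebra \<and>
     (\<forall>a b. a \<le> b \<longrightarrow> (\<Sum>c\<in>{a..b}. m a c) = (if a = b then 1 else 0))"
proof (rule ex1I[of _ moebius_rec], intro conjI allI impI)
  show "(moebius_rec :: 'a \<Rightarrow> 'a \<Rightarrow> 'r) \<in> incidence_algebra"
    by (auto simp: incidence_algebra_def moebius_rec.simps)
next
  fix a b :: 'a
  assume ab: "a \<le> b"
  show "(\<Sum>c\<in>{a..b}. moebius_rec a c) = (if a = b then 1 else 0 :: 'r)"
    using ab by (simp add: sum_atLeastAtMost_last moebius_rec.simps[of a b])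
next
  fix m :: "'a \<Rightarrow> 'a \<Rightarrow> 'r"
  assume m: "m \<in> incidence_algebra \<and>
     (\<forall>a b. a \<le> b \<longrightarrow> (\<Sum>c\<in>{a..b}. m a c) = (if a = b then 1 else 0))"
  have "m a b = moebius_rec a b" for a b
  proof (induction a b rule: moebius_rec.induct)
    case (1 a b)
    show ?case
    proof (cases "a \<le> b")
      case False
      with m show ?thesis by (auto simp: incidence_algebra_def moebius_rec.simps)
    next
      case True
      with m have eq: "m a b + (\<Sum>c\<in>{a..<b}. m a c) = (if a = b then 1 else 0)"
        using sum_atLeastAtMost_last[of a b "m a"] by auto
      show ?thesis
      proof (cases "a = b")
        case True
        with eq show ?thesis by (simp add: moebius_rec.simps)
      next
        case False
        with True 1 have "(\<Sum>c\<in>{a..<b}. m a c) = (\<Sum>c\<in>{a..<b}. moebius_rec a c)"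
          by (intro sum.cong) auto
        with eq False True show ?thesis
          by (simp add: moebius_rec.simps[of a b] eq_neg_iff_add_eq_0)
      qed
    qed
  qed
  then show "m = moebius_rec" by (intro ext)
qed

definition meet_closed :: "'a::semilattice_inf set \<Rightarrow> bool" where
  "meet_closed S \<longleftrightarrow> (\<forall>a\<in>S. \<forall>b\<in>S. inf a b \<in> S)"

text \<open>Enumerations are indexed from \<open>0\<close>: the elements are \<open>a 0, \<dots>, a (n - 1)\<close>, as for matrix
  indices.\<close>

definition linear_extension :: "'a::order set \<Rightarrow> nat \<Rightarrow> (nat \<Rightarrow> 'a) \<Rightarrow> bool" where
  "linear_extension S n a \<longleftrightarrow>
     bij_betw a {..<n} S \<and> (\<forall>i<n. \<forall>j<n. a i < a j \<longrightarrow> i < j)"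

text \<open>\<open>first_above a d i\<close> is the relation \<open>d \<unlhd> a\<^sub>i\<close>, which depends on the whole enumeration.\<close>

definition first_above :: "(nat \<Rightarrow> 'a::order) \<Rightarrow> 'a \<Rightarrow> nat \<Rightarrow> bool" where
  "first_above a d i \<longleftrightarrow> d \<le> a i \<and> (\<forall>j<i. \<not> d \<le> a j)"

definition meet_matrix ::
  "nat \<Rightarrow> (nat \<Rightarrow> 'a::semilattice_inf) \<Rightarrow> ('a \<Rightarrow> 'a \<Rightarrow> 'r::comm_ring_1) \<Rightarrow> 'r mat" where
  "meet_matrix n a f = mat n n (\<lambda>(i, j). f (inf (a i) (a j)) (a i))"

end

theory Submission
  imports Defs
begin

text \<open>Put \<open>g i d = (\<Sum>c. \<mu>(c,d) f(c, a\<^sub>i))\<close>. Moebius inversion gives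
  \<open>f(b, a\<^sub>i) = (\<Sum>d\<le>b. g i d)\<close>. Group the \<open>d\<close> below \<open>a\<^sub>i \<and> a\<^sub>j\<close> by the unique \<open>k\<close> with
  \<open>d \<unlhd> a\<^sub>k\<close>: meet closure makes \<open>d \<le> a\<^sub>j\<close> equivalent to \<open>a\<^sub>k \<le> a\<^sub>j\<close>. Hence the matrix is \<open>B * C\<close> with
  \<open>B i k = [a\<^sub>k \<le> a\<^sub>i] (\<Sum>d\<unlhd>a\<^sub>k. g i d)\<close> lower triangular and \<open>C k j = [a\<^sub>k \<le> a\<^sub>j]\<close> upper
  unitriangular.\<close>

lemma
  fixes x y :: "'a::{finite,order}"
  shows moebius_in_incidence_algebra:
      "(moebius :: 'a \<Rightarrow> 'a \<Rightarrow> 'r::comm_ring_1) \<in> incidence_algebra"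
    and sum_moebius_atLeastAtMost:
      "x \<le> y \<Longrightarrow> (\<Sum>c\<in>{x..y}. (moebius x c :: 'r)) = (if x = y then 1 else 0)"
  using theI'[OF moebius_ex1[where 'a = 'a and 'r = 'r], folded moebius_def] by auto

text \<open>Terms with \<open>d\<close> not above \<open>c\<close> vanish because
  \<open>moebius\<close> lies in the incidence algebra, so the sum may run over the whole down-set
  of \<open>b\<close>. This frees the range of \<open>d\<close> from \<open>c\<close>, as the
  exchange of sums in the inversion requires.\<close>

lemma sum_moebius_atMost:
  fixes c b :: "'a::{finite,order}"
  shows "(\<Sum>d\<in>{..b}. moebius c d) = (if c = b then 1 else 0 :: 'r::comm_ring_1)"
proof -
  have "(\<Sum>d\<in>{..b}. moebius c d) = (\<Sum>d\<in>{c..b}. moebius c d :: 'r)"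
    using moebius_in_incidence_algebra[where 'a = 'a and 'r = 'r]
    by (intro sum.mono_neutral_right) (auto simp: incidence_algebra_def)
  also have "\<dots> = (if c = b then 1 else 0)"
    by (cases "c \<le> b") (auto simp: sum_moebius_atLeastAtMost)
  finally show ?thesis .
qed

text \<open>After exchanging the sums, the coefficient of \<open>h c\<close> is the Kronecker delta
  of \<open>c\<close> and \<open>b\<close>.\<close>

lemma moebius_inversion:
  fixes h :: "'a::{finite,order} \<Rightarrow> 'r::comm_ring_1"
  shows "(\<Sum>d\<in>{..b}. \<Sum>c\<in>UNIV. moebius c d * h c) = h b"
proof -
  have "(\<Sum>d\<in>{..b}. \<Sum>c\<in>UNIV. moebius c d * h c)
      = (\<Sum>c\<in>UNIV. (\<Sum>d\<in>{..b}. moebius c d) * h c)"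
    by (subst sum.swap) (simp add: sum_distrib_right)
  also have "\<dots> = (\<Sum>c\<in>UNIV. if c = b then h c else 0)"
    unfolding sum_moebius_atMost by (intro sum.cong) auto
  finally show ?thesis by simp
qed

text \<open>The definition constrains only strict comparisons; equal values are settled by
  injectivity of the enumeration.\<close>

lemma linear_extension_le:
  assumes "linear_extension S n a" "i < n" "j < n" "a i \<le> a j"
  shows "i \<le> j"
proof (cases "a i = a j")
  case True
  with assms show ?thesis
    by (auto simp: linear_extension_def bij_betw_def dest: inj_onD)
next
  case False
  with assms show ?thesis by (force simp: linear_extension_def)
qed

lemma first_above_exists:
  assumes "d \<le> a j"
  obtains k where "k \<le> j" "first_above a d k"
proof
  show "(LEAST k. d \<le> a k) \<le> j" by (rule Least_le) (rule assms)
  show "first_above a d (LEAST k. d \<le> a k)"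
    unfolding first_above_def
    using LeastI[of "\<lambda>k. d \<le> a k", OF assms] not_less_Least[of _ "\<lambda>k. d \<le> a k"] by blast
qed

lemma first_above_unique:
  assumes "first_above a d k" "first_above a d l"
  shows "k = l"
  using assms unfolding first_above_def by (meson linorder_neqE_nat)

text \<open>By meet closure \<open>inf (a k) (a j)\<close> is some \<open>a m\<close>, and the
  linear extension gives \<open>m \<le> k\<close>. If \<open>d \<le> a j\<close>, then
  \<open>d \<le> a m\<close>, so minimality of \<open>k\<close> forces \<open>m = k\<close>.\<close>

lemma first_above_le_iff:
  fixes a :: "nat \<Rightarrow> 'a::semilattice_inf"
  assumes "meet_closed S" and ext: "linear_extension S n a"
    and "k < n" "j < n" and d: "first_above a d k"
  shows "d \<le> a j \<longleftrightarrow> a k \<le> a j"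
proof
  assume "d \<le> a j"
  have im: "a ` {..<n} = S"
    using ext by (simp add: linear_extension_def bij_betw_def)
  then have "inf (a k) (a j) \<in> a ` {..<n}"
    using assms(1,3,4) by (auto simp: meet_closed_def)
  then obtain m where m: "m < n" "inf (a k) (a j) = a m" by auto
  then have "a m \<le> a k" by (metis inf_le1)
  then have "m \<le> k" using linear_extension_le[OF ext] m(1) \<open>k < n\<close> by blast
  moreover have "d \<le> a m"
    using d \<open>d \<le> a j\<close> m(2) by (metis first_above_def le_inf_iff)
  ultimately have "m = k" using d unfolding first_above_def by (meson le_neq_implies_less)
  with m(2) show "a k \<le> a j" by (simp add: inf.absorb_iff1)
next
  assume "a k \<le> a j"
  with d show "d \<le> a j" unfolding first_above_def by (blast intro: order_trans)
qed

text \<open>By \<open>first_above_le_iff\<close>, each class \<open>{d. first_above a d k}\<close>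
  with \<open>k < n\<close> lies entirely below \<open>a j\<close> or avoids its down-set, and
  likewise for \<open>a i\<close>. So the down-set of the meet is a disjoint union of whole
  classes.\<close>

lemma sum_below_meet:
  fixes a :: "nat \<Rightarrow> 'a::{finite,semilattice_inf}" and g :: "'a \<Rightarrow> 'r::comm_ring_1"
  assumes "meet_closed S" "linear_extension S n a" "i < n" "j < n"
  shows "(\<Sum>d\<in>{..inf (a i) (a j)}. g d) =
    (\<Sum>k<n. if a k \<le> a i \<and> a k \<le> a j then \<Sum>d | first_above a d k. g d else 0)"
proof -
  let ?K = "{k. k < n \<and> a k \<le> a i \<and> a k \<le> a j}"
  have eq: "{..inf (a i) (a j)} = (\<Union>k\<in>?K. {d. first_above a d k})" (is "?L = ?R")
  proof
    show "?L \<subseteq> ?R"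
    proof
      fix d assume "d \<in> ?L"
      then have d: "d \<le> a i" "d \<le> a j" by auto
      then obtain k where "k \<le> j" "first_above a d k"
        using first_above_exists by blast
      \<comment> \<open>\<open>first_above\<close> itself does not bound its index by
        \<open>n\<close>.\<close>
      moreover from \<open>k \<le> j\<close> \<open>j < n\<close> have "k < n" by simp
      ultimately show "d \<in> ?R"
        using first_above_le_iff[OF assms(1,2)] d assms(3,4) by blast
    qed
    show "?R \<subseteq> ?L"
      unfolding first_above_def by (auto intro: order_trans)
  qed
  have "(\<Sum>d\<in>{..inf (a i) (a j)}. g d) = (\<Sum>k\<in>?K. \<Sum>d | first_above a d k. g d)"
    unfolding eq by (rule sum.UNION_disjoint) (auto dest: first_above_unique)
  also have "\<dots> = (\<Sum>k<n. if a k \<le> a i \<and> a k \<le> a j then \<Sum>d | first_above a d k. g d else 0)"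
    by (simp add: sum.If_cases Int_def)
  finally show ?thesis .
qed

theorem theorem4p1:
  fixes f :: "'a::{finite,semilattice_inf} \<Rightarrow> 'a \<Rightarrow> 'r::comm_ring_1"
    and S :: "'a set" and n :: nat and a :: "nat \<Rightarrow> 'a"
  assumes "f \<in> incidence_algebra"
    and "meet_closed S"
    and "linear_extension S n a"
  shows "det (meet_matrix n a f) =
    (\<Prod>i<n. \<Sum>d\<in>{d. first_above a d i}. \<Sum>c\<in>UNIV. moebius c d * f c (a i))"
proof -
  define g where "g i d = (\<Sum>c\<in>UNIV. moebius c d * f c (a i))" for i d
  \<comment> \<open>The summand \<open>g i\<close> varies with the row \<open>i\<close>, since
    \<open>f\<close> is evaluated at \<open>a i\<close> in its second argument. On the diagonal the
    condition holds trivially and the entries are the factors of the claimed product.\<close>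
  define B where "B = mat n n (\<lambda>(i, k). if a k \<le> a i then \<Sum>d | first_above a d k. g i d else 0)"
  define C where "C = mat n n (\<lambda>(k, j). if a k \<le> a j then 1 else 0 :: 'r)"
  have carrier: "B \<in> carrier_mat n n" "C \<in> carrier_mat n n"
    by (simp_all add: B_def C_def)
  have "meet_matrix n a f = B * C"
  proof (rule eq_matI)
    fix i j assume "i < dim_row (B * C)" "j < dim_col (B * C)"
    then have ij: "i < n" "j < n" using carrier by auto
    \<comment> \<open>Inversion is applied in the first argument of \<open>f\<close>, with the
      second fixed at \<open>a i\<close>.\<close>
    have "f (inf (a i) (a j)) (a i) = (\<Sum>d\<in>{..inf (a i) (a j)}. g i d)"
      unfolding g_def by (rule moebius_inversion[symmetric])
    also have "\<dots> =
        (\<Sum>k<n. if a k \<le> a i \<and> a k \<le> a j then \<Sum>d | first_above a d k. g i d else 0)"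
      using assms(2,3) ij by (rule sum_below_meet)
    also have "\<dots> = (B * C) $$ (i, j)"
      using ij by (auto simp: B_def C_def scalar_prod_def atLeast0LessThan intro!: sum.cong)
    finally show "meet_matrix n a f $$ (i, j) = (B * C) $$ (i, j)"
      using ij by (simp add: meet_matrix_def)
  qed (use carrier in \<open>auto simp: meet_matrix_def\<close>)
  then have "det (meet_matrix n a f) = det B * det C"
    using det_mult[OF carrier] by simp
  also have "det B = prod_list (diag_mat B)"
  proof (rule det_lower_triangular[OF _ carrier(1)])
    fix i k assume "i < k" "k < n"
    then show "B $$ (i, k) = 0"
      \<comment> \<open>A nonzero entry would need \<open>a k \<le> a i\<close>, hence
        \<open>k \<le> i\<close>.\<close>
      using linear_extension_le[OF assms(3), of k i] by (auto simp: B_def)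
  qed
  also have "\<dots> = (\<Prod>i<n. \<Sum>d | first_above a d i. g i d)"
    by (simp add: prod_list_diag_prod B_def atLeast0LessThan)
  also have "det C = prod_list (diag_mat C)"
  proof (rule det_upper_triangular[OF _ carrier(2)])
    have "C $$ (k, j) = 0" if "k < n" "j < k" for k j
      using that linear_extension_le[OF assms(3), of k j] by (auto simp: C_def)
    then show "upper_triangular C"
      using carrier by (auto simp: upper_triangular_def)
  qed
  also have "\<dots> = 1"
    by (simp add: prod_list_diag_prod C_def)
  finally show ?thesis by (simp add: g_def)
qed

end
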